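(* Let $p\ge 0$ be a real number, $k\ge 1$ an integer, and $n$ an integer with $n\ge (p+1)k$. Then $|\mathit{Gen}_p(n,k)|=n-k+1-\lceil p\rceil$.
   Context: The weight of a binary word is its number of 1's. For a real $p\ge 0$ and integers $k\ge 0$, $n\ge (p+1)k$, $C_n(p,k)$ is the set of binary words of length $n$ and weight $k$ such that in every prefix the number of 0's is at least $p$ times the number of 1's. A homogeneous transposition of a binary word exchanges a 1 and a 0 such that no 1 occurs strictly between the two exchanged positions. For a set $S$ of binary words of the same length and weight and $\alpha\in S$, the list obtained by applying the greedy algorithm for $S$ to $\alpha$ is built as follows: start with the list $(\alpha)$; repeatedly, for the last word $w$ of the current list, among all words obtainable from $w$ by one homogeneous transposition that lie in $S$ and do not already occur in the list, choose the one obtained by transposing the leftmost possible 1 with (among transpositions of that 1) the leftmost possible 0, and append it; stop when no such word exists. $\mathcal{D}_p(\alpha)$ denotes the list obtained by applying the greedy algorithm for $C_n(p,k)$ to $\alpha\in C_n(p,k)$, and $\mathit{Gen}_p(n,k)$ is the set of $\alpha\in C_n(p,k)$ such that $\mathcal{D}_p(\alpha)$ contains every word of $C_n(p,k)$. *)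

theory Defs
  imports Complex_Main
begin

definition weight :: "bool list \<Rightarrow> nat" where
  "weight w = length (filter id w)"

definition zeros :: "bool list \<Rightarrow> nat" where
  "zeros w = length (filter Not w)"

definition C :: "real \<Rightarrow> nat \<Rightarrow> nat \<Rightarrow> bool list set" where
  "C p n k = {w. length w = n \<and> weight w = k \<and>
      (\<forall>m \<le> length w. real (zeros (take m w)) \<ge> p * real (weight (take m w)))}"

definition homog_transp_ok :: "bool list \<Rightarrow> nat \<Rightarrow> nat \<Rightarrow> bool" where
  "homog_transp_ok w i j \<longleftrightarrow> i < length w \<and> j < length w \<and> w ! i \<and> \<not> w ! j \<and>
      (\<forall>l. min i j < l \<and> l < max i j \<longrightarrow> \<not> w ! l)"

definition transp :: "bool list \<Rightarrow> nat \<Rightarrow> nat \<Rightarrow> bool list" where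
  "transp w i j = w[i := w ! j, j := w ! i]"

definition admissible :: "bool list set \<Rightarrow> bool list list \<Rightarrow> bool list \<Rightarrow> nat \<Rightarrow> nat \<Rightarrow> bool" where
  "admissible S L w i j \<longleftrightarrow> homog_transp_ok w i j \<and> transp w i j \<in> S \<and> transp w i j \<notin> set L"

definition greedy_step :: "bool list set \<Rightarrow> bool list list \<Rightarrow> bool list list" where
  "greedy_step S L =
     (let w = last L in
      if \<exists>i j. admissible S L w i j then
        (let i0 = (LEAST i. \<exists>j. admissible S L w i j);
             j0 = (LEAST j. admissible S L w i0 j)
         in L @ [transp w i0 j0])
      else L)"

text \<open>The greedy list: iterate the step; since each effective step appends a new word of the
  finite set S, after card S iterations the algorithm has stopped.\<close>
definition greedy :: "bool list set \<Rightarrow> bool list \<Rightarrow> bool list list" where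
  "greedy S \<alpha> = (greedy_step S ^^ card S) [\<alpha>]"

definition D :: "real \<Rightarrow> nat \<Rightarrow> nat \<Rightarrow> bool list \<Rightarrow> bool list list" where
  "D p n k \<alpha> = greedy (C p n k) \<alpha>"

definition Gen :: "real \<Rightarrow> nat \<Rightarrow> nat \<Rightarrow> bool list set" where
  "Gen p n k = {\<alpha> \<in> C p n k. C p n k \<subseteq> set (D p n k \<alpha>)}"

end

(* Encode a word by the numbers of zeros in front of its ones. Between two moves of the
   rightmost one, the greedy algorithm runs on the prefix in front of it, so its behaviour can be
   found by induction on k. Let lo be the sequence of least admissible values ceil(p i). From every
   word other than (m,...,m), where m = n - k, the algorithm ends in (m,...,m): if the prefix
   ends with all its entries equal to the current value of the rightmost one, then that one can
   only go up, and never returns to a smaller value. Hence everything is visited iff the start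
   is max(t, lo) (entrywise) for some t <= m. The induction also has to control the end of a run
   from (m,...,m); there two types of behaviour alternate with the parity of k.
   There is one generator max(t, lo) for each t with ceil(p) <= t <= m. *)

theory Submission
  imports Defs
begin

section \<open>Codes of words and the greedy step on codes\<close>

text \<open>A word with \<open>m\<close> zeros is encoded by the list of the numbers of zeros in front of its ones,
  rightmost one first; \<open>enc\<close> below decodes it. Fixing the head \<open>a\<close> leaves an encoded word with
  \<open>a\<close> zeros, and the prefix condition becomes a list \<open>lo\<close> of lower bounds for the entries.\<close>

fun dec :: "nat \<Rightarrow> nat list \<Rightarrow> bool" where
  "dec m [] \<longleftrightarrow> True"
| "dec m (a # z) \<longleftrightarrow> a \<le> m \<and> dec a z"

definition valid :: "nat list \<Rightarrow> nat \<Rightarrow> nat list \<Rightarrow> bool" where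
  "valid lo m z \<longleftrightarrow> dec m z \<and> list_all2 (\<le>) lo z"

definition tuples :: "nat list \<Rightarrow> nat \<Rightarrow> nat list set" where
  "tuples lo m = {z. valid lo m z}"

definition slice :: "nat list set \<Rightarrow> nat \<Rightarrow> nat list set" where
  "slice V a = {z. a # z \<in> V}"

text \<open>These are the candidates for generators. As \<open>t\<close> grows they lead from the
  least code \<open>lo\<close> to (m,...,m), the word with all its ones at the right end.\<close>

abbreviation raised :: "nat list \<Rightarrow> nat \<Rightarrow> nat list" where
  "raised lo t \<equiv> map (max t) lo"

text \<open>The greedy step: the rightmost one moves only if no one to its left can.\<close>

fun nxt :: "nat list \<Rightarrow> nat \<Rightarrow> nat list set \<Rightarrow> nat list \<Rightarrow> nat list option" where
  "nxt (l # lo) m V (a # z) =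
     (case nxt lo a (slice V a) z of
        Some y \<Rightarrow> Some (a # y)
      | None \<Rightarrow> if \<exists>b. valid (l # lo) m (b # z) \<and> b # z \<notin> V
                then Some ((LEAST b. valid (l # lo) m (b # z) \<and> b # z \<notin> V) # z) else None)"
| "nxt _ _ _ _ = None"

text \<open>The greedy rule depends on the list only through its last word and the set of its words,
  so exactly these two are tracked.\<close>

inductive steps :: "nat list \<Rightarrow> nat \<Rightarrow> nat list set \<Rightarrow> nat list \<Rightarrow> nat list set \<Rightarrow> nat list \<Rightarrow> bool"
  for lo m where
  refl: "steps lo m V z V z"
| step: "nxt lo m V z = Some y \<Longrightarrow> steps lo m (insert y V) y V' z' \<Longrightarrow> steps lo m V z V' z'"

text \<open>Only the start counts as visited: this is the situation of a prefix whenever the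
  rightmost one reaches a new value.\<close>

definition run :: "nat list \<Rightarrow> nat \<Rightarrow> nat list \<Rightarrow> nat list set \<Rightarrow> nat list \<Rightarrow> bool" where
  "run lo m z W y \<longleftrightarrow> steps lo m {z} z W y \<and> nxt lo m W y = None"

section \<open>Valid codes and sequences of greedy moves\<close>

lemma valid_Nil [simp]: "valid [] m z \<longleftrightarrow> z = []"
  by (auto simp: valid_def)

lemma valid_Cons [simp]: "valid (l # lo) m (a # z) \<longleftrightarrow> l \<le> a \<and> a \<le> m \<and> valid lo a z"
  by (auto simp: valid_def)

lemma valid_ConsE:
  assumes "valid (l # lo) m z"
  obtains a y where "z = a # y" "l \<le> a" "a \<le> m" "valid lo a y"
  using assms by (cases z) (auto simp: valid_def)

lemma mem_slice [simp]: "z \<in> slice V a \<longleftrightarrow> a # z \<in> V"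
  by (simp add: slice_def)

lemma slice_insert:
  "slice (insert (a # z) V) b = (if b = a then insert z (slice V a) else slice V b)"
  by (auto simp: slice_def)

lemma slice_singleton: "slice {a # z} b = (if b = a then {z} else {})"
  by (auto simp: slice_def)

lemma dec_mono: "dec a z \<Longrightarrow> a \<le> b \<Longrightarrow> dec b z"
  by (cases z) auto

lemma valid_raised:
  assumes "sorted_wrt (\<ge>) lo" "\<forall>x\<in>set lo. x \<le> m" "t \<le> m"
  shows "valid lo m (raised lo t)"
  using assms
proof (induction lo arbitrary: m)
  case (Cons l lo)
  have "valid lo (max t l) (raised lo t)" using Cons.prems by (intro Cons.IH) auto
  then show ?case using Cons.prems by auto
qed simp

lemma nxt_SomeD:
  assumes "valid lo m z" "nxt lo m V z = Some y"
  shows "valid lo m y \<and> y \<notin> V"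
  using assms
proof (induction lo m V z arbitrary: y rule: nxt.induct)
  case (1 l lo m V a z)
  show ?case
  proof (cases "nxt lo a (slice V a) z")
    case None
    with 1(3) have ex: "\<exists>b. valid (l # lo) m (b # z) \<and> b # z \<notin> V"
      and y: "y = (LEAST b. valid (l # lo) m (b # z) \<and> b # z \<notin> V) # z"
      by (auto split: if_splits)
    show ?thesis using LeastI_ex[OF ex] y by blast
  next
    case (Some x)
    then show ?thesis using 1 by auto
  qed
qed auto

lemma steps_valid:
  assumes "steps lo m V z V' z'" "valid lo m z" "V \<subseteq> tuples lo m"
  shows "valid lo m z' \<and> V' \<subseteq> tuples lo m"
  using assms by (induction rule: steps.induct) (auto dest: nxt_SomeD simp: tuples_def)

lemma steps_mem: "steps lo m V z V' z' \<Longrightarrow> z \<in> V \<Longrightarrow> z' \<in> V'"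
  by (induction rule: steps.induct) auto

lemma steps_trans:
  "steps lo m V z V' z' \<Longrightarrow> steps lo m V' z' V'' z'' \<Longrightarrow> steps lo m V z V'' z''"
  by (induction rule: steps.induct) (auto intro: steps.intros)

lemma steps_snoc:
  "steps lo m V z V' z' \<Longrightarrow> nxt lo m V' z' = Some y \<Longrightarrow> steps lo m V z (insert y V') y"
  by (meson steps_trans steps.intros)

section \<open>Runs of the prefix inside runs of the whole code\<close>

text \<open>\<open>nxt\<close> consults the prefix first and sees only the slice at the current
  head. Hence moves of the prefix are moves of the whole code, and all other slices stay as they
  are.\<close>

lemma steps_lift:
  assumes "steps lo a U z W y" "slice V a = U"
  shows "\<exists>V'. steps (l # lo) m V (a # z) V' (a # y) \<and> slice V' a = W \<and>
           (\<forall>b. b \<noteq> a \<longrightarrow> slice V' b = slice V b)"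
  using assms
proof (induction arbitrary: V rule: steps.induct)
  case (refl U z)
  then show ?case using steps.refl by blast
next
  case (step U z y V' z')
  have "nxt (l # lo) m V (a # z) = Some (a # y)" using step by simp
  moreover have "slice (insert (a # y) V) a = insert y U"
    using step.prems by (simp add: slice_insert)
  from step.IH[OF this] obtain V1 where
    "steps (l # lo) m (insert (a # y) V) (a # y) V1 (a # z')" "slice V1 a = V'"
    "\<forall>b. b \<noteq> a \<longrightarrow> slice V1 b = slice V b" by (auto simp: slice_insert)
  ultimately show ?case using steps.step by blast
qed

lemma run_lift:
  assumes "run lo a z W y" "slice V a = {z}"
  obtains V' where "steps (l # lo) m V (a # z) V' (a # y)" "slice V' a = W"
    "\<forall>b. b \<noteq> a \<longrightarrow> slice V' b = slice V b" "nxt lo a (slice V' a) y = None"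
  using steps_lift[of lo a "{z}" z W y V] assms unfolding run_def by blast

lemma nxt_move:
  assumes "nxt lo a (slice V a) y = None" "valid (l # lo) m (b # y)" "b # y \<notin> V"
    "\<And>b'. b' < b \<Longrightarrow> valid (l # lo) m (b' # y) \<Longrightarrow> b' # y \<in> V"
  shows "nxt (l # lo) m V (a # y) = Some (b # y)"
proof -
  have "(LEAST b. valid (l # lo) m (b # y) \<and> b # y \<notin> V) = b"
    using assms(2-4) by (intro Least_equality) (auto simp: not_less[symmetric])
  then show ?thesis using assms(1-3) by auto
qed

lemma nxt_stuck:
  assumes "nxt lo a (slice V a) y = None" "\<And>b. valid (l # lo) m (b # y) \<Longrightarrow> b # y \<in> V"
  shows "nxt (l # lo) m V (a # y) = None"
  using assms by auto

text \<open>Completeness is checked head by head, so that results on the prefix apply to each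
  slice.\<close>

lemma tuples_Cons_eq:
  assumes "V \<subseteq> tuples (l # lo) m"
  shows "V = tuples (l # lo) m \<longleftrightarrow> (\<forall>b. l \<le> b \<and> b \<le> m \<longrightarrow> slice V b = tuples lo b)"
proof
  assume "V = tuples (l # lo) m"
  then show "\<forall>b. l \<le> b \<and> b \<le> m \<longrightarrow> slice V b = tuples lo b"
    by (auto simp: tuples_def slice_def)
next
  assume *: "\<forall>b. l \<le> b \<and> b \<le> m \<longrightarrow> slice V b = tuples lo b"
  have "tuples (l # lo) m \<subseteq> V"
  proof
    fix z assume "z \<in> tuples (l # lo) m"
    then obtain a y where "z = a # y" "l \<le> a" "a \<le> m" "y \<in> tuples lo a"
      by (auto simp: tuples_def elim: valid_ConsE)
    then show "z \<in> V" using * by (metis mem_slice)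
  qed
  then show "V = tuples (l # lo) m" using assms by blast
qed

section \<open>Climbing of the rightmost one\<close>

text \<open>This is the main induction hypothesis. The end of the run is recorded for incomplete
  runs too, since the whole code continues from there. Runs from (m,...,m) follow other rules, given
  by \<open>descending\<close> and \<open>resetting\<close>.\<close>

definition converges :: "nat list \<Rightarrow> bool" where
  "converges lo \<longleftrightarrow> (\<forall>m z. valid lo m z \<and> z \<noteq> raised lo m \<longrightarrow>
     (\<exists>W. run lo m z W (raised lo m) \<and> (W = tuples lo m \<longleftrightarrow> (\<exists>t\<le>m. z = raised lo t))))"

lemma valid_hd_le: "valid lo m z \<Longrightarrow> z \<noteq> [] \<Longrightarrow> hd z \<le> m"
  by (cases z) (auto simp: valid_def)

lemma run_empty: "run [] m [] {[]} []"
  by (auto simp: run_def intro: steps.refl)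

text \<open>This applies after the rightmost one has moved up to \<open>v\<close>. The strict bounds
  keep a nonempty \<open>raised lo t\<close> apart from \<open>raised lo v\<close>, so
  \<open>converges\<close> yields a complete run of the prefix.\<close>

lemma run_raise:
  assumes "converges lo" "sorted_wrt (\<ge>) lo" "t < v" "\<forall>x\<in>set lo. x < v"
  shows "run lo v (raised lo t) (tuples lo v) (raised lo v)"
proof (cases lo)
  case Nil
  then show ?thesis using run_empty by (simp add: tuples_def)
next
  case (Cons x xs)
  have "valid lo v (raised lo t)" using assms by (intro valid_raised) auto
  moreover have "raised lo t \<noteq> raised lo v" using Cons assms by auto
  ultimately obtain W where W: "run lo v (raised lo t) W (raised lo v)"
    "W = tuples lo v \<longleftrightarrow> (\<exists>t'\<le>v. raised lo t = raised lo t')"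
    using assms(1) unfolding converges_def by blast
  then have "W = tuples lo v" using assms(3) less_imp_le by blast
  with W show ?thesis by simp
qed

text \<open>Once the prefix is (u,...,u), its first entry keeps the rightmost one from going below
  \<open>u\<close>, so it moves to \<open>Suc u\<close>; there the prefix runs through everything by
  \<open>run_raise\<close>. An empty prefix blocks nothing, and then \<open>below\<close> says that
  the lower values are already used up.\<close>

lemma climb_last:
  assumes conv: "converges lo" and srt: "sorted_wrt (\<ge>) lo" and le: "\<forall>x\<in>set lo. x \<le> l"
    and "l \<le> a" "a \<le> u" "u \<le> m" "run lo a z W (raised lo a)" "slice V a = {z}"
    "\<forall>b. a < b \<and> b \<le> u \<longrightarrow> slice V b = {}"
    and below: "lo \<noteq> [] \<or> (\<forall>b. l \<le> b \<and> b < a \<longrightarrow> [] \<in> slice V b)"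
  shows "\<exists>V'. steps (l # lo) m V (a # z) V' (u # raised lo u) \<and>
     nxt lo u (slice V' u) (raised lo u) = None \<and> slice V' a = W \<and>
     (\<forall>b. a < b \<and> b \<le> u \<longrightarrow> slice V' b = tuples lo b) \<and>
     (\<forall>b. b < a \<or> u < b \<longrightarrow> slice V' b = slice V b)"
  using assms(5,6,9)
proof (induction u rule: dec_induct)
  case base
  from run_lift[OF assms(7,8)] obtain V' where "steps (l # lo) m V (a # z) V' (a # raised lo a)"
    "slice V' a = W" "\<forall>b. b \<noteq> a \<longrightarrow> slice V' b = slice V b" "nxt lo a (slice V' a) (raised lo a) = None"
    by metis
  then show ?case by (intro exI[of _ V']) auto
next
  case (step u)
  then obtain V1 where V1: "steps (l # lo) m V (a # z) V1 (u # raised lo u)"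
     "nxt lo u (slice V1 u) (raised lo u) = None" "slice V1 a = W"
     "\<forall>b. a < b \<and> b \<le> u \<longrightarrow> slice V1 b = tuples lo b"
     "\<forall>b. b < a \<or> u < b \<longrightarrow> slice V1 b = slice V b" by auto
  have lu: "l \<le> u" using step(1) assms(4) by simp
  have vu: "valid lo u (raised lo u)" using lu le srt by (intro valid_raised) auto
  have u_in: "u # raised lo u \<in> V1"
    using steps_mem[OF V1(1)] assms(8) by (metis insertI1 mem_slice)
  have e: "slice V1 (Suc u) = {}" using V1(5) step by auto
  have nx: "nxt (l # lo) m V1 (u # raised lo u) = Some (Suc u # raised lo u)"
  proof (rule nxt_move[OF V1(2)])
    show "valid (l # lo) m (Suc u # raised lo u)"
      using lu vu step.prems by (auto simp: valid_def intro: dec_mono)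
    show "Suc u # raised lo u \<notin> V1" using e by (metis empty_iff mem_slice)
    fix b' assume b': "b' < Suc u" "valid (l # lo) m (b' # raised lo u)"
    show "b' # raised lo u \<in> V1"
    proof (cases "b' = u")
      case False
      then have bu: "b' < u" using b' by simp
      show ?thesis
      proof (cases lo)
        case Nil
        have "[] \<in> slice V1 b'"
        proof -
          consider "b' < a" | "b' = a" | "a < b'" by linarith
          then show ?thesis
          proof cases
            case 1
            then show ?thesis using below Nil V1(5) b' by auto
          next
            case 2
            have "W = {[]}" using assms(7) Nil by (auto simp: run_def elim: steps.cases)
            then show ?thesis using 2 V1(3) by simp
          next
            case 3
            then show ?thesis using V1(4) bu Nil by (auto simp: tuples_def)
          qed
        qed
        then show ?thesis using Nil by simp
      next
        case (Cons x xs)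
        then show ?thesis using b' bu valid_hd_le[of lo b' "raised lo u"] by auto
      qed
    qed (use u_in in auto)
  qed
  have sl: "slice (insert (Suc u # raised lo u) V1) (Suc u) = {raised lo u}" using e by (simp add: slice_insert)
  have "run lo (Suc u) (raised lo u) (tuples lo (Suc u)) (raised lo (Suc u))"
    using lu le by (intro run_raise[OF conv srt]) auto
  from run_lift[OF this sl, of l m] obtain V2 where V2:
    "steps (l # lo) m (insert (Suc u # raised lo u) V1) (Suc u # raised lo u) V2 (Suc u # raised lo (Suc u))"
    "slice V2 (Suc u) = tuples lo (Suc u)"
    "\<forall>b. b \<noteq> Suc u \<longrightarrow> slice V2 b = slice (insert (Suc u # raised lo u) V1) b"
    "nxt lo (Suc u) (slice V2 (Suc u)) (raised lo (Suc u)) = None" .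
  have "\<forall>b. b \<noteq> Suc u \<longrightarrow> slice V2 b = slice V1 b" using V2(3) by (simp add: slice_insert)
  moreover have "steps (l # lo) m V (a # z) V2 (Suc u # raised lo (Suc u))"
    using steps_trans[OF steps_snoc[OF V1(1) nx] V2(1)] .
  ultimately show ?case using V1 V2 step(1) by (intro exI[of _ V2]) (auto simp: le_Suc_eq)
qed

section \<open>Runs that start from (m,...,m)\<close>

text \<open>The two possible behaviours of a run from \<open>raised lo m\<close>, as \<open>m\<close> varies: the end either
  follows \<open>m\<close> at distance one, or does not depend on \<open>m\<close>. They alternate as ones are appended.\<close>

definition descending :: "nat list \<Rightarrow> bool" where
  "descending lo \<longleftrightarrow> lo \<noteq> [] \<and>
     (\<exists>c\<le>hd lo. run lo (hd lo) (raised lo (hd lo)) (tuples lo (hd lo)) (raised lo c)) \<and>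
     (\<forall>m>hd lo. run lo m (raised lo m) (tuples lo m) (raised lo (m - 1)))"

definition resetting :: "nat list \<Rightarrow> bool" where
  "resetting lo \<longleftrightarrow> (\<exists>c. (lo \<noteq> [] \<longrightarrow> c \<le> hd lo) \<and>
     (\<forall>m. (\<forall>x\<in>set lo. x \<le> m) \<longrightarrow> run lo m (raised lo m) (tuples lo m) (raised lo c)))"

text \<open>Started at \<open>a\<close>, the rightmost one takes each of the values from \<open>l\<close> to \<open>a\<close> exactly once,
  and all prefixes are visited for each of them.\<close>

definition sweeps :: "nat \<Rightarrow> nat list \<Rightarrow> nat \<Rightarrow> nat \<Rightarrow> nat \<Rightarrow> bool" where
  "sweeps l lo a b x \<longleftrightarrow> (\<forall>m V. a \<le> m \<longrightarrow> slice V a = {raised lo a} \<longrightarrow>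
     (\<forall>b'. l \<le> b' \<and> b' < a \<longrightarrow> slice V b' = {}) \<longrightarrow>
     (\<exists>V'. steps (l # lo) m V (a # raised lo a) V' (b # raised lo x) \<and>
        nxt lo b (slice V' b) (raised lo x) = None \<and>
        (\<forall>b'. l \<le> b' \<and> b' \<le> a \<longrightarrow> slice V' b' = tuples lo b') \<and>
        (\<forall>b'>a. slice V' b' = slice V b')))"

lemma valid_raised_Cons: "sorted_wrt (\<ge>) (l # lo) \<Longrightarrow> t \<le> b \<Longrightarrow> l \<le> b \<Longrightarrow> valid lo b (raised lo t)"
  by (rule valid_raised) auto

lemma nonempty_hd_le:
  "sorted_wrt (\<ge>) (l # lo) \<Longrightarrow> lo \<noteq> [] \<Longrightarrow> hd lo \<le> l"
  by (cases lo) auto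

text \<open>At a value \<open>a > l\<close> the prefix runs from (a,...,a) to (a-1,...,a-1). Its
  first entry then allows the rightmost one to go down to \<open>a - 1\<close> and no further, and
  this repeats until \<open>l\<close> is reached.\<close>

lemma sweeps_descending:
  assumes desc: "descending lo" and srt: "sorted_wrt (\<ge>) (l # lo)"
  shows "\<exists>c\<le>l. \<forall>a\<ge>l. sweeps l lo a l c"
proof -
  have ne: "lo \<noteq> []" using desc by (simp add: descending_def)
  have hl: "hd lo \<le> l" using nonempty_hd_le[OF srt ne] .
  obtain c where c: "c \<le> l" "run lo l (raised lo l) (tuples lo l) (raised lo c)"
  \<comment> \<open>If \<open>l\<close> is the bound of the head of the prefix, that head cannot go
    down to \<open>l - 1\<close> and the prefix ends in some other raised list. All that is kept is
    that \<open>c\<close> is at most \<open>l\<close>.\<close>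
  proof (cases "l = hd lo")
    case True
    then show ?thesis using desc that by (auto simp: descending_def)
  next
    case False
    then have "run lo l (raised lo l) (tuples lo l) (raised lo (l - 1))"
      using desc hl by (auto simp: descending_def)
    then show ?thesis using that[of "l - 1"] by simp
  qed
  have "sweeps l lo a l c" if "l \<le> a" for a
    using that
  proof (induction a rule: dec_induct)
    case base
    show ?case unfolding sweeps_def
    proof (intro allI impI)
      fix m V assume "slice V l = {raised lo l}"
      from run_lift[OF c(2) this, of l m] obtain V' where
        "steps (l # lo) m V (l # raised lo l) V' (l # raised lo c)" "slice V' l = tuples lo l"
        "\<forall>b. b \<noteq> l \<longrightarrow> slice V' b = slice V b" "nxt lo l (slice V' l) (raised lo c) = None" .
      then show "\<exists>V'. steps (l # lo) m V (l # raised lo l) V' (l # raised lo c) \<and>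
        nxt lo l (slice V' l) (raised lo c) = None \<and>
        (\<forall>b'. l \<le> b' \<and> b' \<le> l \<longrightarrow> slice V' b' = tuples lo b') \<and>
        (\<forall>b'>l. slice V' b' = slice V b')" by (intro exI[of _ V']) auto
    qed
  next
    case (step a)
    show ?case unfolding sweeps_def
    proof (intro allI impI)
      fix m V assume am: "Suc a \<le> m" and V: "slice V (Suc a) = {raised lo (Suc a)}"
        "\<forall>b'. l \<le> b' \<and> b' < Suc a \<longrightarrow> slice V b' = {}"
      have "hd lo < Suc a" using hl step(1) by simp
      with desc have "run lo (Suc a) (raised lo (Suc a)) (tuples lo (Suc a)) (raised lo (Suc a - 1))"
        unfolding descending_def by blast
      then have "run lo (Suc a) (raised lo (Suc a)) (tuples lo (Suc a)) (raised lo a)" by simp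
      from run_lift[OF this V(1), of l m] obtain V1 where V1:
        "steps (l # lo) m V (Suc a # raised lo (Suc a)) V1 (Suc a # raised lo a)"
        "slice V1 (Suc a) = tuples lo (Suc a)" "\<forall>b. b \<noteq> Suc a \<longrightarrow> slice V1 b = slice V b"
        "nxt lo (Suc a) (slice V1 (Suc a)) (raised lo a) = None" .
      have e: "slice V1 a = {}" using V V1(3) step by auto
      have nx: "nxt (l # lo) m V1 (Suc a # raised lo a) = Some (a # raised lo a)"
      proof (rule nxt_move[OF V1(4)])
        show "valid (l # lo) m (a # raised lo a)" using am step valid_raised_Cons[OF srt] by simp
        show "a # raised lo a \<notin> V1" using e by (metis empty_iff mem_slice)
        fix b' assume "b' < a" "valid (l # lo) m (b' # raised lo a)"
        then show "b' # raised lo a \<in> V1" using ne valid_hd_le[of lo b' "raised lo a"]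
          by (cases lo) auto
      qed
      let ?V = "insert (a # raised lo a) V1"
      have "slice ?V a = {raised lo a}" using e by (simp add: slice_insert)
      moreover have "\<forall>b'. l \<le> b' \<and> b' < a \<longrightarrow> slice ?V b' = {}"
        using V V1(3) by (simp add: slice_insert)
      ultimately obtain V2 where V2: "steps (l # lo) m ?V (a # raised lo a) V2 (l # raised lo c)"
        "nxt lo l (slice V2 l) (raised lo c) = None"
        "\<forall>b'. l \<le> b' \<and> b' \<le> a \<longrightarrow> slice V2 b' = tuples lo b'"
        "\<forall>b'>a. slice V2 b' = slice ?V b'"
        using step.IH[unfolded sweeps_def, rule_format, of m ?V] am by auto
      have "steps (l # lo) m V (Suc a # raised lo (Suc a)) V2 (l # raised lo c)"
        using steps_trans[OF steps_snoc[OF V1(1) nx] V2(1)] .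
      then show "\<exists>V'. steps (l # lo) m V (Suc a # raised lo (Suc a)) V' (l # raised lo c) \<and>
        nxt lo l (slice V' l) (raised lo c) = None \<and>
        (\<forall>b'. l \<le> b' \<and> b' \<le> Suc a \<longrightarrow> slice V' b' = tuples lo b') \<and>
        (\<forall>b'>Suc a. slice V' b' = slice V b')"
        using V1 V2 by (intro exI[of _ V2]) (auto simp: slice_insert le_Suc_eq)
    qed
  qed
  then show ?thesis using c by blast
qed

text \<open>At a value \<open>a > l\<close> the prefix ends in \<open>raised lo c\<close>, whose
  entries are at most \<open>l\<close>, so the rightmost one drops to its least value
  \<open>l\<close>. From there it climbs by \<open>climb_last\<close> through all values below
  \<open>a\<close>, which has been dealt with first.\<close>

lemma sweeps_resetting:
  assumes reset: "resetting lo" and conv: "converges lo" and srt: "sorted_wrt (\<ge>) (l # lo)"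
  shows "\<exists>c\<le>l. sweeps l lo l l c" and "l < a \<Longrightarrow> sweeps l lo a (a - 1) (a - 1)"
proof -
  obtain c0 where c0: "lo \<noteq> [] \<longrightarrow> c0 \<le> hd lo"
    "\<And>m. \<forall>x\<in>set lo. x \<le> m \<Longrightarrow> run lo m (raised lo m) (tuples lo m) (raised lo c0)"
    using reset by (auto simp: resetting_def)
  \<comment> \<open>For the empty prefix the witness \<open>c0\<close> is unrestricted and may
    exceed \<open>l\<close>; as \<open>raised [] c\<close> is always empty, 0 serves
    instead.\<close>
  define c where "c = (if lo = [] then 0 else c0)"
  have cl: "c \<le> l" using c0 nonempty_hd_le[OF srt] by (force simp: c_def)
  have low: "\<forall>x\<in>set lo. x \<le> l" using srt by simp
  have c: "run lo m (raised lo m) (tuples lo m) (raised lo c)" if "l \<le> m" for m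
  proof -
    have "run lo m (raised lo m) (tuples lo m) (raised lo c0)" using low that by (intro c0(2)) auto
    then show ?thesis by (auto simp: c_def)
  qed
  have "sweeps l lo l l c" unfolding sweeps_def
  proof (intro allI impI)
    fix m V assume "slice V l = {raised lo l}"
    from run_lift[OF c[of l] this, of l m] obtain V' where
      "steps (l # lo) m V (l # raised lo l) V' (l # raised lo c)" "slice V' l = tuples lo l"
      "\<forall>b. b \<noteq> l \<longrightarrow> slice V' b = slice V b" "nxt lo l (slice V' l) (raised lo c) = None" by auto
    then show "\<exists>V'. steps (l # lo) m V (l # raised lo l) V' (l # raised lo c) \<and>
      nxt lo l (slice V' l) (raised lo c) = None \<and>
      (\<forall>b'. l \<le> b' \<and> b' \<le> l \<longrightarrow> slice V' b' = tuples lo b') \<and>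
      (\<forall>b'>l. slice V' b' = slice V b')" by (intro exI[of _ V']) auto
  qed
  then show "\<exists>c\<le>l. sweeps l lo l l c" using cl by blast
  show "sweeps l lo a (a - 1) (a - 1)" if la: "l < a"
    unfolding sweeps_def
  proof (intro allI impI)
    fix m V assume am: "a \<le> m" and V: "slice V a = {raised lo a}"
      "\<forall>b'. l \<le> b' \<and> b' < a \<longrightarrow> slice V b' = {}"
    from run_lift[OF c[of a] V(1), of l m] la obtain V1 where V1:
      "steps (l # lo) m V (a # raised lo a) V1 (a # raised lo c)" "slice V1 a = tuples lo a"
      "\<forall>b. b \<noteq> a \<longrightarrow> slice V1 b = slice V b" "nxt lo a (slice V1 a) (raised lo c) = None"
      by auto
    have e: "slice V1 l = {}" using V V1(3) la by auto
    have nx: "nxt (l # lo) m V1 (a # raised lo c) = Some (l # raised lo c)"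
    proof (rule nxt_move[OF V1(4)])
      show "valid (l # lo) m (l # raised lo c)" using am la cl valid_raised_Cons[OF srt] by simp
      show "l # raised lo c \<notin> V1" using e by (metis empty_iff mem_slice)
    qed auto
    let ?V = "insert (l # raised lo c) V1"
    have sl: "slice ?V l = {raised lo c}" using e by (simp add: slice_insert)
    have run: "run lo l (raised lo c) (tuples lo l) (raised lo l)"
    \<comment> \<open>The two lists may coincide, for instance when all bounds equal
      \<open>l\<close>. \<open>converges\<close> is silent then, but the run from (l,...,l) to
      \<open>raised lo c\<close> is already the one wanted.\<close>
    proof (cases "raised lo c = raised lo l")
      case True
      with c[OF order_refl] show ?thesis by (simp only: True)
    next
      case False
      have "valid lo l (raised lo c)" using valid_raised_Cons[OF srt] cl by simp
      then obtain W where "run lo l (raised lo c) W (raised lo l)"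
        "W = tuples lo l \<longleftrightarrow> (\<exists>t\<le>l. raised lo c = raised lo t)"
        using conv False unfolding converges_def by blast
      then show ?thesis using cl by auto
    qed
    have "\<exists>V'. steps (l # lo) m ?V (l # raised lo c) V' ((a-1) # raised lo (a-1)) \<and>
     nxt lo (a-1) (slice V' (a-1)) (raised lo (a-1)) = None \<and> slice V' l = tuples lo l \<and>
     (\<forall>b. l < b \<and> b \<le> a-1 \<longrightarrow> slice V' b = tuples lo b) \<and>
     (\<forall>b. b < l \<or> a-1 < b \<longrightarrow> slice V' b = slice ?V b)"
      using srt la am V V1(3) e
      by (intro climb_last[OF conv _ low _ _ _ run sl]) (auto simp: slice_insert)
    then obtain V2 where V2: "steps (l # lo) m ?V (l # raised lo c) V2 ((a-1) # raised lo (a-1))"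
      "nxt lo (a-1) (slice V2 (a-1)) (raised lo (a-1)) = None" "slice V2 l = tuples lo l"
      "\<forall>b. l < b \<and> b \<le> a-1 \<longrightarrow> slice V2 b = tuples lo b"
      "\<forall>b. b < l \<or> a-1 < b \<longrightarrow> slice V2 b = slice ?V b" by blast
    have "steps (l # lo) m V (a # raised lo a) V2 ((a-1) # raised lo (a-1))"
      using steps_trans[OF steps_snoc[OF V1(1) nx] V2(1)] .
    moreover have "slice V2 b' = tuples lo b'" if b': "l \<le> b'" "b' \<le> a" for b'
    proof -
      consider "b' = l" | "b' = a" | "l < b'" "b' < a" using b' by linarith
      then show ?thesis using V1(2) V2 la by cases (auto simp: slice_insert)
    qed
    ultimately show "\<exists>V'. steps (l # lo) m V (a # raised lo a) V' ((a-1) # raised lo (a-1)) \<and>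
      nxt lo (a-1) (slice V' (a-1)) (raised lo (a-1)) = None \<and>
      (\<forall>b'. l \<le> b' \<and> b' \<le> a \<longrightarrow> slice V' b' = tuples lo b') \<and>
      (\<forall>b'>a. slice V' b' = slice V b')"
      using V1(3) V2 la by (intro exI[of _ V2]) (auto simp: slice_insert)
  qed
qed

text \<open>No value exceeds \<open>m\<close>, so a sweep from \<open>m\<close> visits everything,
  and with nothing left the algorithm stops.\<close>

lemma run_of_sweeps:
  assumes "sweeps l lo m b x" "l \<le> m" "b \<le> m" "x \<le> m" "sorted_wrt (\<ge>) (l # lo)"
  shows "run (l # lo) m (raised (l # lo) m) (tuples (l # lo) m) (b # raised lo x)"
proof -
  have Tm: "raised (l # lo) m = m # raised lo m" using assms by simp
  obtain V' where V': "steps (l # lo) m {m # raised lo m} (m # raised lo m) V' (b # raised lo x)"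
    "nxt lo b (slice V' b) (raised lo x) = None"
    "\<forall>b'. l \<le> b' \<and> b' \<le> m \<longrightarrow> slice V' b' = tuples lo b'"
    using assms(1)[unfolded sweeps_def, rule_format, of m "{m # raised lo m}"]
    by (auto simp: slice_singleton)
  have v: "valid (l # lo) m (m # raised lo m)" using assms valid_raised_Cons[OF assms(5)] by simp
  have "V' \<subseteq> tuples (l # lo) m" using steps_valid[OF V'(1) v] v by (simp add: tuples_def)
  then have V'_eq: "V' = tuples (l # lo) m" using V'(3) tuples_Cons_eq by blast
  have "nxt (l # lo) m V' (b # raised lo x) = None"
    using V'_eq by (intro nxt_stuck[OF V'(2)]) (auto simp: tuples_def)
  then show ?thesis using V'(1) V'_eq Tm by (simp add: run_def)
qed

section \<open>The induction on the number of ones\<close>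

text \<open>Let \<open>a\<close> be the head of the start. If the prefix is not (a,...,a), it ends
  there and the rightmost one climbs to \<open>m\<close> without visiting values below
  \<open>a\<close>; everything is visited iff \<open>a = l\<close> and the prefix run is complete.
  If it is (a,...,a), the rightmost one first sweeps the values from \<open>l\<close> to
  \<open>a\<close> and then climbs on from \<open>Suc a\<close>, so nothing is missed.\<close>

lemma converges_Cons:
  assumes conv: "converges lo" and srt: "sorted_wrt (\<ge>) (l # lo)"
    and sw: "\<And>a. l \<le> a \<Longrightarrow> \<exists>b x. b \<le> a \<and> x \<le> a \<and> sweeps l lo a b x"
  shows "converges (l # lo)"
  unfolding converges_def
proof (intro allI impI, elim conjE)
  fix m z assume z: "valid (l # lo) m z" "z \<noteq> raised (l # lo) m"
  then obtain a z' where z': "z = a # z'" "l \<le> a" "a \<le> m" "valid lo a z'"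
    by (elim valid_ConsE)
  have lm: "l \<le> m" and low: "\<forall>x\<in>set lo. x \<le> l" and srt': "sorted_wrt (\<ge>) lo"
    using z' srt by auto
  have Tm: "raised (l # lo) m = m # raised lo m" using lm by simp
  \<comment> \<open>At (m,...,m) a nonempty prefix forces the head to be \<open>m\<close>; for the
    empty prefix, completeness is what rules out a further move.\<close>
  have finish: "nxt (l # lo) m V' (m # raised lo m) = None"
    if "nxt lo m (slice V' m) (raised lo m) = None" "lo = [] \<Longrightarrow> V' = tuples (l # lo) m"
       "slice V' m = tuples lo m \<or> m # raised lo m \<in> V'" for V'
  proof (rule nxt_stuck[OF that(1)])
    fix b assume b: "valid (l # lo) m (b # raised lo m)"
    show "b # raised lo m \<in> V'"
    proof (cases lo)
      case Nil
      then show ?thesis using that(2) b by (simp add: tuples_def)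
    next
      case (Cons y ys)
      then have "b = m" using b valid_hd_le[of lo b "raised lo m"] by auto
      then show ?thesis using that(3) valid_raised_Cons[OF srt _ lm] by (auto simp: tuples_def set_eq_iff)
    qed
  qed
  show "\<exists>W. run (l # lo) m z W (raised (l # lo) m) \<and>
    (W = tuples (l # lo) m \<longleftrightarrow> (\<exists>t\<le>m. z = raised (l # lo) t))"
  proof (cases "z' = raised lo a")
    case False
    then have ne: "lo \<noteq> []" using z' by auto
    obtain W where W: "run lo a z' W (raised lo a)" "W = tuples lo a \<longleftrightarrow> (\<exists>t\<le>a. z' = raised lo t)"
      using conv z' False unfolding converges_def by blast
    have "\<exists>V'. steps (l # lo) m {a # z'} (a # z') V' (m # raised lo m) \<and>
     nxt lo m (slice V' m) (raised lo m) = None \<and> slice V' a = W \<and>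
     (\<forall>b. a < b \<and> b \<le> m \<longrightarrow> slice V' b = tuples lo b) \<and>
     (\<forall>b. b < a \<or> m < b \<longrightarrow> slice V' b = slice {a # z'} b)"
      using z' ne by (intro climb_last[OF conv srt' low _ _ _ W(1)]) (auto simp: slice_singleton)
    then obtain V' where V': "steps (l # lo) m {a # z'} (a # z') V' (m # raised lo m)"
      "nxt lo m (slice V' m) (raised lo m) = None" "slice V' a = W"
      "\<forall>b. a < b \<and> b \<le> m \<longrightarrow> slice V' b = tuples lo b"
      "\<forall>b. b < a \<longrightarrow> slice V' b = {}" by (auto simp: slice_singleton)
    have "m # raised lo m \<in> V'" using steps_mem[OF V'(1)] by simp
    then have run: "run (l # lo) m z V' (raised (l # lo) m)"
      using V' finish[OF V'(2)] ne Tm z' by (simp add: run_def)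
    have sub: "V' \<subseteq> tuples (l # lo) m" using steps_valid[OF V'(1)] z z' by (simp add: tuples_def)
    have "V' = tuples (l # lo) m \<longleftrightarrow> a = l \<and> W = tuples lo a"
    proof
      assume V'_full: "V' = tuples (l # lo) m"
      have "raised lo l \<in> tuples lo l" using valid_raised_Cons[OF srt] by (simp add: tuples_def)
      then have "slice V' l \<noteq> {}" using V'_full tuples_Cons_eq[OF sub] lm by auto
      then have "a = l" using V'(5) z'(2) by (metis le_neq_implies_less)
      then show "a = l \<and> W = tuples lo a" using V'_full tuples_Cons_eq[OF sub] V'(3) lm by auto
    next
      assume "a = l \<and> W = tuples lo a"
      then show "V' = tuples (l # lo) m" using tuples_Cons_eq[OF sub] V'
        by (metis le_neq_implies_less)
    qed
    \<comment> \<open>If \<open>a = l\<close> and \<open>t\<close> is at most \<open>a\<close>,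
      raising \<open>l\<close> to \<open>t\<close> gives \<open>l\<close> again. Conversely
      \<open>a = max t l\<close>, and \<open>t = a\<close> would make the prefix (a,...,a), so
      \<open>a = l\<close>.\<close>
    also have "\<dots> \<longleftrightarrow> (\<exists>t\<le>m. z = raised (l # lo) t)"
    proof
      assume "a = l \<and> W = tuples lo a"
      then obtain t where "t \<le> a" "z' = raised lo t" "a = l" using W by blast
      then show "\<exists>t\<le>m. z = raised (l # lo) t" using z' by (intro exI[of _ t]) auto
    next
      assume "\<exists>t\<le>m. z = raised (l # lo) t"
      then obtain t where t: "t \<le> m" "a = max t l" "z' = raised lo t" using z' by auto
      with False have "a = l" "t \<le> a" by (auto simp: max_def split: if_splits)
      then show "a = l \<and> W = tuples lo a" using W t by auto
    qed
    finally show ?thesis using run by blast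
  next
    case True
    have am: "a < m" using z z' Tm True by (metis le_neq_implies_less)
    obtain b x where bx: "b \<le> a" "x \<le> a" "sweeps l lo a b x" using sw z' by blast
    obtain V1 where V1: "steps (l # lo) m {a # raised lo a} (a # raised lo a) V1 (b # raised lo x)"
      "nxt lo b (slice V1 b) (raised lo x) = None"
      "\<forall>b'. l \<le> b' \<and> b' \<le> a \<longrightarrow> slice V1 b' = tuples lo b'"
      "\<forall>b'>a. slice V1 b' = {}"
      using bx(3)[unfolded sweeps_def, rule_format, of m "{a # raised lo a}"] z'
      by (auto simp: slice_singleton)
    \<comment> \<open>Every value from \<open>l\<close> to \<open>a\<close> has been combined with
      every prefix, so the least free value is \<open>Suc a\<close>. It exists because the start is
      not (m,...,m).\<close>
    have nx: "nxt (l # lo) m V1 (b # raised lo x) = Some (Suc a # raised lo x)"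
    proof (rule nxt_move[OF V1(2)])
      show "valid (l # lo) m (Suc a # raised lo x)" using am bx z' valid_raised_Cons[OF srt] by simp
      show "Suc a # raised lo x \<notin> V1" using V1(4) by (metis empty_iff lessI mem_slice)
      fix b' assume b': "b' < Suc a" "valid (l # lo) m (b' # raised lo x)"
      then have "raised lo x \<in> slice V1 b'" using V1(3) by (auto simp: tuples_def)
      then show "b' # raised lo x \<in> V1" by simp
    qed
    let ?V = "insert (Suc a # raised lo x) V1"
    have run: "run lo (Suc a) (raised lo x) (tuples lo (Suc a)) (raised lo (Suc a))"
      using bx z' low by (intro run_raise[OF conv srt']) auto
    have sl: "slice ?V (Suc a) = {raised lo x}" using V1(4) by (simp add: slice_insert)
    have below: "lo \<noteq> [] \<or> (\<forall>b. l \<le> b \<and> b < Suc a \<longrightarrow> [] \<in> slice ?V b)"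
    proof (cases lo)
      case Nil
      then have "\<forall>b. l \<le> b \<and> b < Suc a \<longrightarrow> slice V1 b = {[]}"
        using V1(3) by (auto simp: tuples_def)
      then show ?thesis by (metis insertI1 insert_iff mem_slice)
    qed simp
    have "\<exists>V'. steps (l # lo) m ?V (Suc a # raised lo x) V' (m # raised lo m) \<and>
     nxt lo m (slice V' m) (raised lo m) = None \<and> slice V' (Suc a) = tuples lo (Suc a) \<and>
     (\<forall>b. Suc a < b \<and> b \<le> m \<longrightarrow> slice V' b = tuples lo b) \<and>
     (\<forall>b. b < Suc a \<or> m < b \<longrightarrow> slice V' b = slice ?V b)"
      using z' am V1 below by (intro climb_last[OF conv srt' low _ _ _ run sl]) (auto simp: slice_insert)
    then obtain V2 where V2: "steps (l # lo) m ?V (Suc a # raised lo x) V2 (m # raised lo m)"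
      "nxt lo m (slice V2 m) (raised lo m) = None" "slice V2 (Suc a) = tuples lo (Suc a)"
      "\<forall>b. Suc a < b \<and> b \<le> m \<longrightarrow> slice V2 b = tuples lo b"
      "\<forall>b. b < Suc a \<or> m < b \<longrightarrow> slice V2 b = slice ?V b" by blast
    have st: "steps (l # lo) m {z} z V2 (m # raised lo m)"
      using steps_trans[OF steps_snoc[OF V1(1) nx] V2(1)] z' True by simp
    have sub: "V2 \<subseteq> tuples (l # lo) m" using steps_valid[OF st z(1)] z by (simp add: tuples_def)
    have V2_full: "V2 = tuples (l # lo) m"
      unfolding tuples_Cons_eq[OF sub]
    proof (intro allI impI)
      fix b assume b: "l \<le> b \<and> b \<le> m"
      consider "b \<le> a" | "b = Suc a" | "Suc a < b" by linarith
      then show "slice V2 b = tuples lo b"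
        using V1(3) V2 b by cases (auto simp: slice_insert)
    qed
    have "run (l # lo) m z V2 (raised (l # lo) m)"
      using st finish[OF V2(2) V2_full] steps_mem[OF st] Tm by (simp add: run_def)
    moreover have "z = raised (l # lo) a" using z' True by simp
    then have "\<exists>t\<le>m. z = raised (l # lo) t" using z' by blast
    ultimately show ?thesis using V2_full by blast
  qed
qed

text \<open>The empty code is resetting, and each new one switches the behaviour: after a descending
  prefix it always ends at its bound \<open>l\<close>, after a resetting prefix at
  \<open>m - 1\<close> as soon as \<open>m > l\<close>.\<close>

lemma converges_alternating:
  "sorted_wrt (\<ge>) lo \<Longrightarrow> converges lo \<and> (descending lo \<or> resetting lo)"
proof (induction lo)
  case Nil
  have "converges []" by (simp add: converges_def)
  moreover have "resetting []" by (auto simp: resetting_def tuples_def run_empty)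
  ultimately show ?case by blast
next
  case (Cons l lo)
  note srt = Cons.prems
  from Cons have conv: "converges lo" and "descending lo \<or> resetting lo" by auto
  from this(2) show ?case
  proof
    assume "descending lo"
    then obtain c where c: "c \<le> l" "\<And>a. l \<le> a \<Longrightarrow> sweeps l lo a l c"
      using sweeps_descending[OF _ srt] by blast
    have "converges (l # lo)"
      using c by (intro converges_Cons[OF conv srt]) (auto intro: le_trans)
    moreover have "resetting (l # lo)"
      unfolding resetting_def
    \<comment> \<open>As \<open>c\<close> is at most \<open>l\<close>,
      \<open>raised (l # lo) c\<close> is \<open>l # raised lo c\<close>, the end of the sweep for
      every \<open>m\<close>.\<close>
    proof (intro exI[of _ c] conjI allI impI)
      show "c \<le> hd (l # lo)" using c by simp
      fix m assume "\<forall>x\<in>set (l # lo). x \<le> m"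
      then show "run (l # lo) m (raised (l # lo) m) (tuples (l # lo) m) (raised (l # lo) c)"
        using run_of_sweeps[OF c(2)[of m] _ _ _ srt] c(1) by (simp add: max_def)
    qed
    ultimately show ?case by blast
  next
    assume r: "resetting lo"
    note sw = sweeps_resetting[OF r conv srt]
    obtain c where c: "c \<le> l" "sweeps l lo l l c" using sw(1) by blast
    have "\<exists>b x. b \<le> a \<and> x \<le> a \<and> sweeps l lo a b x" if "l \<le> a" for a
    proof (cases "a = l")
      case False
      then have "sweeps l lo a (a - 1) (a - 1)" using sw(2)[of a] that by simp
      then show ?thesis by (meson diff_le_self)
    qed (use c in blast)
    then have "converges (l # lo)" by (intro converges_Cons[OF conv srt]) auto
    moreover have "descending (l # lo)"
      unfolding descending_def
    proof (intro conjI allI impI)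
      show "\<exists>c\<le>hd (l # lo). run (l # lo) (hd (l # lo)) (raised (l # lo) (hd (l # lo)))
          (tuples (l # lo) (hd (l # lo))) (raised (l # lo) c)"
        using run_of_sweeps[OF c(2) _ _ _ srt] c(1) by (intro exI[of _ c]) (simp add: max_def)
      fix m assume m: "m > hd (l # lo)"
      then have "raised (l # lo) (m - 1) = (m - 1) # raised lo (m - 1)" by auto
      then show "run (l # lo) m (raised (l # lo) m) (tuples (l # lo) m) (raised (l # lo) (m - 1))"
        using run_of_sweeps[OF sw(2)[of m] _ _ _ srt] m by simp
    qed simp
    ultimately show ?case by blast
  qed
qed

lemma valid_bound: "valid lo m z \<Longrightarrow> \<forall>x\<in>set lo. x \<le> m"
proof (induction lo arbitrary: m z)
  case (Cons l lo)
  from Cons.prems obtain a y where "l \<le> a" "a \<le> m" "valid lo a y"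
    by (elim valid_ConsE)
  then show ?case using Cons.IH[of a y] by force
qed simp

text \<open>From (m,...,m) both behaviours give a complete run; \<open>converges\<close> settles all
  other starts.\<close>

lemma run_covers:
  assumes "sorted_wrt (\<ge>) lo" "valid lo m z"
  shows "\<exists>W y. run lo m z W y \<and> (W = tuples lo m \<longleftrightarrow> (\<exists>t\<le>m. z = raised lo t))"
proof (cases "z = raised lo m")
  case True
  have le: "\<forall>x\<in>set lo. x \<le> m"
    using assms(2) by (rule valid_bound)
  have conv: "descending lo \<or> resetting lo" using converges_alternating[OF assms(1)] by blast
  have "\<exists>y. run lo m z (tuples lo m) y"
  proof -
    have "hd lo \<le> m" if "lo \<noteq> []" using that le by simp
    then show ?thesis using conv le True unfolding descending_def resetting_def
      by (metis le_neq_implies_less)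
  qed
  then show ?thesis using True by blast
next
  case False
  then show ?thesis using converges_alternating[OF assms(1)] assms(2)
    unfolding converges_def by blast
qed

section \<open>Codes as words, and transpositions of words\<close>

fun enc :: "nat \<Rightarrow> nat list \<Rightarrow> bool list" where
  "enc m [] = replicate m False"
| "enc m (a # z) = enc a z @ True # replicate (m - a) False"

lemma length_enc: "dec m z \<Longrightarrow> length (enc m z) = m + length z"
  by (induction m z rule: enc.induct) auto

text \<open>The trailing zeros can be read off from the reversed word, and they determine where the
  last 1 stands.\<close>

lemma snoc_True_inject:
  assumes "u @ True # replicate r False = u' @ True # replicate r' False"
  shows "u = u' \<and> r = r'"
proof -
  have *: "takeWhile Not (rev (u @ True # replicate r False)) = replicate r False" for u r
    by (simp add: takeWhile_append)
  have "replicate r False = replicate r' False"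
    using arg_cong[OF assms, of "\<lambda>w. takeWhile Not (rev w)"] unfolding * .
  then have "r = r'" by (metis length_replicate)
  then show ?thesis using assms by simp
qed

lemma enc_inject: "dec m y \<Longrightarrow> dec m z \<Longrightarrow> enc m y = enc m z \<Longrightarrow> y = z"
proof (induction m y arbitrary: z rule: enc.induct)
  case (1 m)
  show ?case
  proof (cases z)
    case (Cons b z')
    then have "True \<in> set (replicate m False)"
      using 1(3) by simp
    then show ?thesis by simp
  qed simp
next
  case (2 m a y)
  show ?case
  proof (cases z)
    case Nil
    then have "True \<in> set (replicate m False)" using 2(4)[symmetric] by simp
    then show ?thesis by simp
  next
    case (Cons b z')
    then have "enc a y = enc b z' \<and> m - a = m - b"
      using 2(4) by (intro snoc_True_inject) simp
    moreover have "a \<le> m" "b \<le> m" "dec a y" "dec b z'" using 2(2,3) Cons by auto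
    moreover from calculation have "a = b" by linarith
    ultimately show ?thesis using 2(1)[of z'] Cons by simp
  qed
qed

lemma enc_extend: "dec b z \<Longrightarrow> b \<le> a \<Longrightarrow> enc a z = enc b z @ replicate (a - b) False"
  by (cases z) (auto simp: replicate_add[symmetric])

text \<open>The 1 behind \<open>u\<close> is a barrier: for a partner beyond it, it would lie
  strictly between the exchanged positions.\<close>

lemma homog_append:
  assumes "i < length u"
  shows "homog_transp_ok (u @ True # v) i j \<longleftrightarrow> homog_transp_ok u i j"
proof
  assume h: "homog_transp_ok (u @ True # v) i j"
  then have "j \<noteq> length u" by (auto simp: homog_transp_ok_def)
  moreover have "\<not> length u < j"
  proof
    assume "length u < j"
    then have "\<not> (u @ True # v) ! length u" using h assms unfolding homog_transp_ok_def
      by (auto simp: min_def max_def split: if_splits)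
    then show False by simp
  qed
  ultimately have "j < length u" by simp
  moreover have "\<not> u ! l" if "min i j < l" "l < max i j" for l
  proof -
    have "l < length u" using that assms \<open>j < length u\<close> by linarith
    then show ?thesis using h that by (auto simp: homog_transp_ok_def nth_append)
  qed
  ultimately show "homog_transp_ok u i j" using h assms
    unfolding homog_transp_ok_def by (auto simp: nth_append)
next
  assume "homog_transp_ok u i j"
  then show "homog_transp_ok (u @ True # v) i j" using assms
    unfolding homog_transp_ok_def by (auto simp: nth_append)
qed

lemma transp_append:
  "i < length u \<Longrightarrow> j < length u \<Longrightarrow> transp (u @ v) i j = transp u i j @ v"
  by (simp add: transp_def nth_append list_update_append)

text \<open>The rightmost one reaches exactly the zeros behind the one before it. In the resulting
  word \<open>b\<close> zeros and \<open>length z\<close> ones precede it, hence the position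
  \<open>b + length z\<close>.\<close>

lemma homog_last:
  assumes z: "dec a z" and am: "a \<le> m"
  shows "homog_transp_ok (enc m (a # z)) (a + length z) j \<longleftrightarrow>
    (\<exists>b\<le>m. b \<noteq> a \<and> dec b z \<and> j = b + length z)"
proof
  let ?w = "enc m (a # z)"
  assume h: "homog_transp_ok ?w (a + length z) j"
  have lw: "length ?w = m + length z + 1" using length_enc[of m "a # z"] z am by simp
  have j: "j < m + length z + 1" "\<not> ?w ! j" using h lw by (auto simp: homog_transp_ok_def)
  have ja: "j \<noteq> a + length z" using j(2) length_enc[OF z] by (auto simp: nth_append)
  show "\<exists>b\<le>m. b \<noteq> a \<and> dec b z \<and> j = b + length z"
  proof (cases z)
    case Nil
    then show ?thesis using j ja by auto
  next
    case (Cons c z')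
    have lc: "length (enc c z') = c + length z'" "c \<le> a" using z Cons length_enc by auto
    \<comment> \<open>This is the last 1 of \<open>enc a z\<close>; it shuts off all zeros to its
      left.\<close>
    have one: "?w ! (c + length z')" using lc Cons by (simp add: nth_append)
    have "\<not> j < c + length z'"
      using h one lc Cons unfolding homog_transp_ok_def by auto
    moreover have "j \<noteq> c + length z'" using one j(2) by metis
    ultimately have "c + length z \<le> j" using Cons by simp
    then have "dec (j - length z) z" "j = (j - length z) + length z" using z Cons by auto
    then show ?thesis using j(1) ja by (intro exI[of _ "j - length z"]) auto
  qed
next
  let ?w = "enc m (a # z)"
  assume "\<exists>b\<le>m. b \<noteq> a \<and> dec b z \<and> j = b + length z"
  then obtain b where b: "b \<le> m" "b \<noteq> a" "dec b z" "j = b + length z" by blast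
  have lw: "length ?w = m + length z + 1" using length_enc[of m "a # z"] z am by simp
  have la: "length (enc a z) = a + length z" "length (enc b z) = b + length z"
    using z b length_enc by auto
  have up: "\<not> ?w ! l" if "a + length z < l" "l < m + length z + 1" for l
    using that la by (auto simp: nth_append nth_Cons')
  have dn: "\<not> ?w ! l" if "b + length z \<le> l" "l < a + length z" for l
  proof -
    have "enc a z = enc b z @ replicate (a - b) False" using b that by (intro enc_extend) auto
    then show ?thesis using that la by (auto simp: nth_append)
  qed
  have "?w ! (a + length z)" using la by (simp add: nth_append)
  then show "homog_transp_ok ?w (a + length z) j"
    unfolding homog_transp_ok_def lw using b am up dn
    by (cases "b < a") (auto simp: min_def max_def)
qed

lemma transp_last:
  assumes "dec a z" "a \<le> m" "dec b z" "b \<le> m" "b \<noteq> a"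
  shows "transp (enc m (a # z)) (a + length z) (b + length z) = enc m (b # z)"
proof (rule nth_equalityI)
  let ?w = "enc m (a # z)"
  have lw: "length ?w = m + length z + 1" "length (enc m (b # z)) = m + length z + 1"
    using length_enc[of m "a # z"] length_enc[of m "b # z"] assms by auto
  then show "length (transp ?w (a + length z) (b + length z)) = length (enc m (b # z))"
    by (simp add: transp_def)
  have la: "length (enc a z) = a + length z" "length (enc b z) = b + length z"
    using assms length_enc by auto
  have nwb: "\<not> ?w ! (b + length z)"
    using homog_last[OF assms(1,2), of "b + length z"] assms by (auto simp: homog_transp_ok_def)
  have wa: "?w ! (a + length z)" using la by (simp add: nth_append)
  fix l assume "l < length (transp ?w (a + length z) (b + length z))"
  then have l: "l < m + length z + 1" using lw by (simp add: transp_def)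
  \<comment> \<open>The words in front of the moved 1 differ only in their trailing zeros;
    \<open>max\<close> and \<open>min\<close> cover both directions of the move.\<close>
  have *: "enc (max a b) z = enc (min a b) z @ replicate (max a b - min a b) False"
    using assms by (intro enc_extend) (auto simp: min_def)
  show "transp ?w (a + length z) (b + length z) ! l = enc m (b # z) ! l"
    using l lw la nwb wa assms * unfolding transp_def
    by (cases "a < b") (auto simp: nth_list_update nth_append nth_Cons' min_def max_def)
qed

section \<open>The greedy algorithm on words follows \<open>nxt\<close>\<close>

text \<open>\<open>F\<close> stands for the words of \<open>S\<close> outside the list. A single set
  of allowed words can be restricted to prefixes, as the induction in \<open>nxt_correct\<close>
  requires.\<close>

definition legal :: "bool list set \<Rightarrow> bool list \<Rightarrow> nat \<Rightarrow> nat \<Rightarrow> bool" where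
  "legal F w i j \<longleftrightarrow> homog_transp_ok w i j \<and> transp w i j \<in> F"

text \<open>The greedy choice is the lexicographically least pair (i, j). Ones of the prefix come
  first, and by \<open>homog_append\<close> their moves stay in the prefix. For the rightmost one
  \<open>j\<close> grows with \<open>b\<close>, so the least \<open>b\<close> gives the leftmost
  0.\<close>

lemma nxt_correct:
  assumes "valid lo m z" "z \<in> V"
    "\<And>y. dec m y \<Longrightarrow> length y = length z \<Longrightarrow> enc m y \<in> F \<longleftrightarrow> valid lo m y \<and> y \<notin> V"
  shows "case nxt lo m V z of
      None \<Rightarrow> \<forall>i j. \<not> legal F (enc m z) i j
    | Some y \<Rightarrow> \<exists>i j. legal F (enc m z) i j \<and> transp (enc m z) i j = enc m y \<and>
        (\<forall>i' j'. legal F (enc m z) i' j' \<longrightarrow> i < i' \<or> i = i' \<and> j \<le> j')"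
  using assms
proof (induction lo m V z arbitrary: F rule: nxt.induct)
  case (1 l lo m V a z)
  have v: "l \<le> a" "a \<le> m" "valid lo a z" "dec a z" using "1.prems"(1) by (auto simp: valid_def)
  define t where "t = True # replicate (m - a) False"
  \<comment> \<open>These are the prefixes that become allowed words when the fixed end
    \<open>t\<close> is attached.\<close>
  define F' where "F' = {u. u @ t \<in> F}"
  let ?w = "enc m (a # z)"
  have w: "?w = enc a z @ t" by (simp add: t_def)
  have lu: "length (enc a z) = a + length z" using v length_enc by simp
  have legal_prefix: "legal F ?w i j \<longleftrightarrow> legal F' (enc a z) i j" if "i < a + length z" for i j
  proof -
    have h: "homog_transp_ok ?w i j \<longleftrightarrow> homog_transp_ok (enc a z) i j"
      using homog_append[of i "enc a z"] that lu by (simp add: w t_def)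
    show ?thesis
    proof (cases "homog_transp_ok (enc a z) i j")
      case True
      then have "transp ?w i j = transp (enc a z) i j @ t"
        using w by (auto simp: homog_transp_ok_def intro: transp_append)
      then show ?thesis using h by (simp add: legal_def F'_def)
    qed (use h in \<open>simp add: legal_def\<close>)
  qed
  have legal_bound: "i \<le> a + length z" if "legal F ?w i j" for i j
  proof (rule ccontr)
    assume "\<not> i \<le> a + length z"
    moreover have "i < length ?w" "?w ! i" using that by (auto simp: legal_def homog_transp_ok_def)
    ultimately show False using lu by (auto simp: nth_append nth_Cons')
  qed
  have legal_last: "legal F ?w (a + length z) j \<longleftrightarrow>
      (\<exists>b. j = b + length z \<and> valid (l # lo) m (b # z) \<and> b # z \<notin> V)" for j
  proof -
    have "legal F ?w (a + length z) j \<longleftrightarrow>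
        (\<exists>b\<le>m. b \<noteq> a \<and> dec b z \<and> j = b + length z \<and> enc m (b # z) \<in> F)"
      using homog_last[OF v(4,2)] transp_last[OF v(4,2)] unfolding legal_def by metis
    also have "\<dots> \<longleftrightarrow> (\<exists>b. j = b + length z \<and> valid (l # lo) m (b # z) \<and> b # z \<notin> V)"
    proof -
      \<comment> \<open>On the right, \<open>b = a\<close> is excluded because \<open>a # z\<close>
        has been visited.\<close>
      have "b \<le> m \<and> b \<noteq> a \<and> dec b z \<and> enc m (b # z) \<in> F \<longleftrightarrow>
          valid (l # lo) m (b # z) \<and> b # z \<notin> V" for b
        using "1.prems"(2) "1.prems"(3)[of "b # z"] by (auto simp: valid_def)
      then show ?thesis by blast
    qed
    finally show ?thesis .
  qed
  have IH: "case nxt lo a (slice V a) z of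
      None \<Rightarrow> \<forall>i j. \<not> legal F' (enc a z) i j
    | Some y \<Rightarrow> \<exists>i j. legal F' (enc a z) i j \<and> transp (enc a z) i j = enc a y \<and>
        (\<forall>i' j'. legal F' (enc a z) i' j' \<longrightarrow> i < i' \<or> i = i' \<and> j \<le> j')"
  proof (rule "1.IH"[OF v(3)])
    show "z \<in> slice V a" using "1.prems"(2) by simp
    fix y assume "dec a y" "length y = length z"
    then show "enc a y \<in> F' \<longleftrightarrow> valid lo a y \<and> y \<notin> slice V a"
      using "1.prems"(3)[of "a # y"] v by (simp add: F'_def t_def)
  qed
  show ?case
  proof (cases "nxt lo a (slice V a) z")
    case (Some y)
    then obtain i j where ij: "legal F' (enc a z) i j" "transp (enc a z) i j = enc a y"
      "\<And>i' j'. legal F' (enc a z) i' j' \<Longrightarrow> i < i' \<or> i = i' \<and> j \<le> j'"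
      using IH by auto
    have lt: "i < a + length z" "j < a + length z"
      using ij(1) lu by (auto simp: legal_def homog_transp_ok_def)
    have "legal F ?w i j" using legal_prefix lt ij by simp
    moreover have "transp ?w i j = enc m (a # y)"
      using ij(2) lt lu transp_append[of i "enc a z" j t] by (simp add: t_def)
    moreover have "i < i' \<or> i = i' \<and> j \<le> j'" if "legal F ?w i' j'" for i' j'
      using that legal_prefix[of i' j'] ij(3)[of i' j'] lt by (cases "i' < a + length z") auto
    ultimately show ?thesis using Some by auto
  next
    case None
    then have no: "\<not> legal F ?w i j" if "i < a + length z" for i j
      using IH legal_prefix that by simp
    let ?P = "\<lambda>b. valid (l # lo) m (b # z) \<and> b # z \<notin> V"
    show ?thesis
    proof (cases "\<exists>b. ?P b")
      case True
      define b where "b = (LEAST b. ?P b)"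
      have b: "?P b" "\<And>b'. ?P b' \<Longrightarrow> b \<le> b'"
        unfolding b_def using LeastI_ex[OF True] Least_le[of ?P] by blast+
      have nx: "nxt (l # lo) m V (a # z) = Some (b # z)"
        using None True by (simp add: b_def)
      have "legal F ?w (a + length z) (b + length z)" using legal_last b by blast
      moreover have "transp ?w (a + length z) (b + length z) = enc m (b # z)"
        using b(1) "1.prems"(2) v by (intro transp_last) (auto simp: valid_def)
      moreover have "a + length z < i' \<or> a + length z = i' \<and> b + length z \<le> j'"
        if "legal F ?w i' j'" for i' j'
      proof -
        have "i' = a + length z" using legal_bound[OF that] no that by (meson le_neq_implies_less)
        then show ?thesis using that legal_last b(2) by auto
      qed
      ultimately show ?thesis unfolding nx by auto
    next
      case False
      then have "nxt (l # lo) m V (a # z) = None" using None by auto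
      moreover have "\<not> legal F ?w i j" for i j
      proof
        assume L: "legal F ?w i j"
        then have "i = a + length z" using legal_bound[OF L] no[of i j] by (meson le_neq_implies_less)
        then show False using L legal_last[of j] False by blast
      qed
      ultimately show ?thesis by auto
    qed
  qed
next
  case ("2_1" m V z)
  then show ?case by (auto simp: legal_def homog_transp_ok_def)
next
  case ("2_2" lo m V)
  then show ?case by (auto simp: legal_def homog_transp_ok_def valid_def)
qed

lemma admissible_legal: "admissible S L w i j \<longleftrightarrow> legal (S - set L) w i j"
  by (simp add: admissible_def legal_def)

lemma greedy_step_enc:
  assumes "valid lo m z" "z \<in> V" "V \<subseteq> tuples lo m" "set L = enc m ` V" "last L = enc m z"
  shows "greedy_step (enc m ` tuples lo m) L =
    (case nxt lo m V z of None \<Rightarrow> L | Some y \<Rightarrow> L @ [enc m y])"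
proof -
  let ?S = "enc m ` tuples lo m"
  have dec: "dec m y" if "y \<in> tuples lo m" for y using that by (simp add: tuples_def valid_def)
  have "enc m y \<in> ?S - set L \<longleftrightarrow> valid lo m y \<and> y \<notin> V" if y: "dec m y" for y
  proof -
    have "enc m y \<in> enc m ` X \<longleftrightarrow> y \<in> X" if "X \<subseteq> tuples lo m" for X
      using that y dec enc_inject by blast
    then show ?thesis using assms(3,4) by (simp add: tuples_def)
  qed
  then have *: "case nxt lo m V z of
      None \<Rightarrow> \<forall>i j. \<not> legal (?S - set L) (enc m z) i j
    | Some y \<Rightarrow> \<exists>i j. legal (?S - set L) (enc m z) i j \<and> transp (enc m z) i j = enc m y \<and>
        (\<forall>i' j'. legal (?S - set L) (enc m z) i' j' \<longrightarrow> i < i' \<or> i = i' \<and> j \<le> j')"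
    by (intro nxt_correct[OF assms(1,2)])
  show ?thesis
  proof (cases "nxt lo m V z")
    case None
    then show ?thesis using * assms(5) by (simp add: greedy_step_def admissible_legal Let_def)
  next
    case (Some y)
    let ?A = "legal (?S - set L) (enc m z)"
    obtain i j where ij: "?A i j" "transp (enc m z) i j = enc m y"
      "\<And>i' j'. ?A i' j' \<Longrightarrow> i < i' \<or> i = i' \<and> j \<le> j'" using * Some by auto
    have i0: "(LEAST i. \<exists>j. ?A i j) = i"
      using ij by (intro Least_equality) (auto intro: less_imp_le)
    have j0: "(LEAST j. ?A i j) = j" using ij by (intro Least_equality) auto
    have "\<exists>i j. ?A i j" using ij(1) by blast
    then show ?thesis using Some ij(2)
      unfolding greedy_step_def Let_def assms(5) admissible_legal i0 j0 by simp
  qed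
qed

text \<open>Distinctness and length of the list are carried along in order to bound the number
  \<open>N\<close> of steps.\<close>

lemma greedy_steps:
  assumes "steps lo m V z V' z'" "valid lo m z" "z \<in> V" "V \<subseteq> tuples lo m"
    "set L = enc m ` V" "last L = enc m z" "distinct L"
  shows "\<exists>N L'. (greedy_step (enc m ` tuples lo m) ^^ N) L = L' \<and> set L' = enc m ` V' \<and>
    last L' = enc m z' \<and> distinct L' \<and> length L' = length L + N"
  using assms
proof (induction arbitrary: L rule: steps.induct)
  case (refl V z)
  then show ?case by (intro exI[of _ 0]) auto
next
  case (step V z y V' z')
  have y: "valid lo m y" "y \<notin> V" using nxt_SomeD step.prems(1) step.hyps(1) by blast+
  have s: "greedy_step (enc m ` tuples lo m) L = L @ [enc m y]"
    using greedy_step_enc[OF step.prems(1-5)] step.hyps(1) by simp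
  have "enc m y \<notin> enc m ` V"
  proof
    assume "enc m y \<in> enc m ` V"
    then obtain x where "x \<in> V" "enc m y = enc m x" by blast
    moreover from this have "valid lo m x" using step.prems(3) by (auto simp: tuples_def)
    ultimately have "y = x" using y(1) by (intro enc_inject) (auto simp: valid_def)
    then show False using y(2) \<open>x \<in> V\<close> by simp
  qed
  then obtain N L' where "(greedy_step (enc m ` tuples lo m) ^^ N) (L @ [enc m y]) = L'"
     "set L' = enc m ` V'" "last L' = enc m z'" "distinct L'" "length L' = Suc (length L) + N"
    using step.IH[of "L @ [enc m y]"] step.prems y by (auto simp: tuples_def)
  then show ?case using s by (intro exI[of _ "Suc N"] exI[of _ L']) (simp add: funpow_swap1)
qed

lemma finite_enc_tuples: "finite (enc m ` tuples lo m)"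
proof (rule finite_subset)
  show "enc m ` tuples lo m \<subseteq> {w. set w \<subseteq> UNIV \<and> length w = m + length lo}"
    by (auto simp: tuples_def valid_def length_enc dest: list_all2_lengthD)
qed (rule finite_lists_length_eq, simp)

lemma funpow_fixpoint: "f x = x \<Longrightarrow> (f ^^ n) x = x"
  by (induction n) auto

text \<open>The list has \<open>N + 1\<close> distinct entries, so the run is over before
  \<open>card\<close> many iterations; the remaining ones leave the stuck list unchanged.\<close>

lemma set_greedy_run:
  assumes "run lo m z W y" "valid lo m z"
  shows "set (greedy (enc m ` tuples lo m) (enc m z)) = enc m ` W"
proof -
  let ?S = "enc m ` tuples lo m"
  have st: "steps lo m {z} z W y" and stuck: "nxt lo m W y = None"
    using assms(1) by (auto simp: run_def)
  have W: "valid lo m y" "W \<subseteq> tuples lo m" "y \<in> W"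
    using steps_valid[OF st assms(2)] steps_mem[OF st] assms(2) by (auto simp: tuples_def)
  obtain N L where L: "(greedy_step ?S ^^ N) [enc m z] = L" "set L = enc m ` W"
    "last L = enc m y" "distinct L" "length L = 1 + N"
    using greedy_steps[OF st assms(2), of "[enc m z]"] assms(2) by (auto simp: tuples_def)
  have fixed: "greedy_step ?S L = L" using greedy_step_enc[OF W(1,3,2) L(2,3)] stuck by simp
  have "length L \<le> card ?S" using L(2,4) W(2) finite_enc_tuples
    by (metis card_mono distinct_card image_mono)
  then have "card ?S = (card ?S - N) + N" using L(5) by simp
  then have "greedy ?S (enc m z) = (greedy_step ?S ^^ (card ?S - N)) ((greedy_step ?S ^^ N) [enc m z])"
    unfolding greedy_def by (metis comp_apply funpow_add)
  also have "\<dots> = L" using L(1) funpow_fixpoint[of "greedy_step ?S", OF fixed] by simp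
  finally show ?thesis using L(2) by simp
qed

section \<open>The prefix condition as lower bounds\<close>

lemma weight_simps [simp]:
  "weight [] = 0" "weight (b # w) = (if b then 1 else 0) + weight w"
  "weight (u @ v) = weight u + weight v" "weight (replicate r False) = 0"
  by (auto simp: weight_def)

lemma zeros_simps [simp]:
  "zeros [] = 0" "zeros (b # w) = (if b then 0 else 1) + zeros w"
  "zeros (u @ v) = zeros u + zeros v" "zeros (replicate r False) = r"
  by (auto simp: zeros_def)

lemma weight_eq_0: "True \<notin> set w \<Longrightarrow> weight w = 0"
  by (induction w) auto

lemma zeros_plus_weight: "zeros w + weight w = length w"
  by (induction w) auto

definition ballot :: "real \<Rightarrow> bool list \<Rightarrow> bool" where
  "ballot p w \<longleftrightarrow> (\<forall>j\<le>length w. p * real (weight (take j w)) \<le> real (zeros (take j w)))"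

text \<open>Trailing zeros only help, so beyond \<open>u\<close> the one critical prefix is the one
  that ends with the new 1.\<close>

lemma ballot_snoc:
  "ballot p (u @ True # replicate r False) \<longleftrightarrow>
    ballot p u \<and> p * real (Suc (weight u)) \<le> real (zeros u)" (is "?l \<longleftrightarrow> ?r")
proof
  assume l: ?l
  have "ballot p u"
    unfolding ballot_def
  proof (intro allI impI)
    fix j assume "j \<le> length u"
    then show "p * real (weight (take j u)) \<le> real (zeros (take j u))"
      using l[unfolded ballot_def, rule_format, of j] by simp
  qed
  moreover have "p * real (Suc (weight u)) \<le> real (zeros u)"
    using l[unfolded ballot_def, rule_format, of "Suc (length u)"] by simp
  ultimately show ?r by blast
next
  assume r: ?r
  show ?l
    unfolding ballot_def
  proof (intro allI impI)
    fix j assume j: "j \<le> length (u @ True # replicate r False)"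
    show "p * real (weight (take j (u @ True # replicate r False)))
      \<le> real (zeros (take j (u @ True # replicate r False)))"
    proof (cases "j \<le> length u")
      case True
      then show ?thesis using r by (simp add: ballot_def)
    next
      case False
      then obtain i where "j = length u + Suc i" by (metis less_imp_Suc_add not_le add_Suc_right)
      then show ?thesis using r by (auto simp: take_Cons')
    qed
  qed
qed

text \<open>The i-th one from the left needs at least \<open>p * i\<close> zeros in front of it, and
  their number is an integer; the rightmost one is listed first, as in codes.\<close>

primrec lows :: "real \<Rightarrow> nat \<Rightarrow> nat list" where
  "lows p 0 = []"
| "lows p (Suc k) = nat \<lceil>p * real (Suc k)\<rceil> # lows p k"

lemma C_eq: "C p n k = {w. length w = n \<and> weight w = k \<and> ballot p w}"
  by (simp add: C_def ballot_def)

text \<open>A word is split at its last 1. The zeros in front of it give the head of the code, and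
  \<open>ballot_snoc\<close> turns the prefix condition into the bound on this head.\<close>

lemma C_iff_enc: "w \<in> C p (m + k) k \<longleftrightarrow> (\<exists>z. valid (lows p k) m z \<and> w = enc m z)"
proof (induction k arbitrary: m w)
  case 0
  have "w \<in> C p m 0 \<longleftrightarrow> w = replicate m False"
  proof
    assume "w \<in> C p m 0"
    then have "length w = m" "\<forall>b\<in>set w. b = False"
      by (auto simp: C_eq weight_def filter_empty_conv)
    then show "w = replicate m False" by (metis replicate_eqI)
  next
    assume "w = replicate m False"
    then show "w \<in> C p m 0" by (simp add: C_eq ballot_def)
  qed
  then show ?case by simp
next
  case (Suc k)
  have low: "nat \<lceil>p * real (Suc k)\<rceil> \<le> a \<longleftrightarrow> p * real (Suc k) \<le> real a" for a
    by (simp add: nat_le_iff ceiling_le_iff)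
  show ?case
  proof
    assume w: "w \<in> C p (m + Suc k) (Suc k)"
    then have "True \<in> set w" using weight_eq_0[of w] by (auto simp: C_eq)
    then obtain u v where uv: "w = u @ True # v" "True \<notin> set v" by (metis split_list_last)
    then have "v = replicate (length v) False" by (metis (full_types) replicate_eqI)
    then obtain r where r: "w = u @ True # replicate r False" using uv by blast
    define a where "a = zeros u"
    have u: "weight u = k" "length u + r = m + k" "ballot p u" "p * real (Suc k) \<le> real a"
      using w unfolding C_eq r by (auto simp: ballot_snoc a_def)
    have lu: "length u = a + k" using zeros_plus_weight[of u] u by (simp add: a_def)
    then have "u \<in> C p (a + k) k" using u by (simp add: C_eq)
    then obtain z where z: "valid (lows p k) a z" "u = enc a z" using Suc.IH by blast
    have "valid (lows p (Suc k)) m (a # z)" using z u low lu by simp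
    moreover have "w = enc m (a # z)" using z r u(2) lu by simp
    ultimately show "\<exists>z. valid (lows p (Suc k)) m z \<and> w = enc m z" by blast
  next
    assume "\<exists>z. valid (lows p (Suc k)) m z \<and> w = enc m z"
    then obtain a z where az: "valid (lows p k) a z" "w = enc m (a # z)" "a \<le> m"
      "p * real (Suc k) \<le> real a" using low by (auto elim: valid_ConsE)
    then have u: "enc a z \<in> C p (a + k) k" using Suc.IH by blast
    then have "zeros (enc a z) = a" using zeros_plus_weight[of "enc a z"] by (simp add: C_eq)
    then show "w \<in> C p (m + Suc k) (Suc k)" using u az by (auto simp: C_eq ballot_snoc)
  qed
qed

lemma low_mono:
  fixes p x y :: real
  shows "0 \<le> p \<Longrightarrow> x \<le> y \<Longrightarrow> nat \<lceil>p * x\<rceil> \<le> nat \<lceil>p * y\<rceil>"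
  by (intro nat_mono ceiling_mono mult_left_mono)

text \<open>The lower estimate fixes where the range of \<open>t\<close> begins in the count; the
  upper one keeps all bounds below or at \<open>m\<close>.\<close>

lemma lows_bounds:
  assumes "p \<ge> 0" "x \<in> set (lows p k)"
  shows "nat \<lceil>p\<rceil> \<le> x" "x \<le> nat \<lceil>p * real k\<rceil>"
proof -
  have "\<exists>i\<ge>1. i \<le> k \<and> x = nat \<lceil>p * real i\<rceil>" using assms(2)
  proof (induction k)
    case (Suc k)
    show ?case
    proof (cases "x \<in> set (lows p k)")
      case True
      then show ?thesis using Suc.IH le_Suc_eq by blast
    next
      case False
      then show ?thesis using Suc.prems by (intro exI[of _ "Suc k"]) simp
    qed
  qed simp
  then obtain i where "i \<ge> 1" "i \<le> k" "x = nat \<lceil>p * real i\<rceil>" by blast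
  then show "nat \<lceil>p\<rceil> \<le> x" "x \<le> nat \<lceil>p * real k\<rceil>"
    using low_mono[OF assms(1), of 1 i] low_mono[OF assms(1), of i k] by simp_all
qed

lemma sorted_lows:
  assumes "p \<ge> 0"
  shows "sorted_wrt (\<ge>) (lows p k)"
proof (induction k)
  case (Suc k)
  have "x \<le> nat \<lceil>p * real (Suc k)\<rceil>" if "x \<in> set (lows p k)" for x
    using lows_bounds(2)[OF assms that] low_mono[OF assms, of k "Suc k"]
    by (meson le_trans lessI less_imp_le of_nat_mono)
  then show ?case using Suc unfolding lows.simps sorted_wrt.simps by blast
qed simp

lemma least_low: "k \<ge> 1 \<Longrightarrow> nat \<lceil>p\<rceil> \<in> set (lows p k)"
  by (induction k rule: nat_induct_at_least) auto

section \<open>Counting the generators\<close>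

theorem theorem4:
  fixes p :: real and n k :: nat
  assumes "p \<ge> 0" and "k \<ge> 1" and "real n \<ge> (p + 1) * real k"
  shows "int (card (Gen p n k)) = int n - int k + 1 - \<lceil>p\<rceil>"
proof -
  define m where "m = n - k"
  define lo where "lo = lows p k"
  define q where "q = nat \<lceil>p\<rceil>"
  have pk: "p * real k + real k \<le> real n" using assms(3) by (simp add: algebra_simps)
  moreover have "0 \<le> p * real k" using assms(1) by simp
  ultimately have n: "n = m + k" unfolding m_def by linarith
  have m: "p * real k \<le> real m" using pk n by simp
  have C: "C p n k = enc m ` tuples lo m"
    using C_iff_enc unfolding n lo_def tuples_def by blast
  have "nat \<lceil>p * real k\<rceil> \<le> m" using m by (simp add: nat_le_iff ceiling_le_iff)
  then have lo: "\<forall>x\<in>set lo. q \<le> x \<and> x \<le> m"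
    using lows_bounds[OF assms(1)] unfolding lo_def q_def by (meson le_trans)
  have q_lo: "q \<in> set lo" and sorted_lo: "sorted_wrt (\<ge>) lo"
    using least_low[OF assms(2)] sorted_lows[OF assms(1)] unfolding lo_def q_def by blast+
  have q_m: "q \<le> m" using lo q_lo by blast
  have inj: "inj_on (enc m) (tuples lo m)"
    using enc_inject by (auto intro!: inj_onI simp: tuples_def valid_def)
  have raised_tuples: "raised lo t \<in> tuples lo m" if "t \<le> m" for t
    using valid_raised[OF sorted_lo _ that] lo by (simp add: tuples_def)
  have "enc m z \<in> Gen p n k \<longleftrightarrow> (\<exists>t\<le>m. z = raised lo t)" if z: "z \<in> tuples lo m" for z
  proof -
    have vz: "valid lo m z" using z by (simp add: tuples_def)
    obtain W y where W: "run lo m z W y" "W = tuples lo m \<longleftrightarrow> (\<exists>t\<le>m. z = raised lo t)"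
      using run_covers[OF sorted_lo vz] by blast
    have "W \<subseteq> tuples lo m" using W(1) steps_valid[of lo m "{z}" z W y] vz
      by (simp add: run_def tuples_def)
    \<comment> \<open>Since \<open>enc m\<close> is injective here, covering all words amounts to
      covering all codes.\<close>
    then have "enc m ` tuples lo m \<subseteq> enc m ` W \<longleftrightarrow> W = tuples lo m"
      using inj_on_image_eq_iff[OF inj order_refl, of W] by blast
    then show ?thesis
      using W(2) z set_greedy_run[OF W(1) vz] by (simp add: Gen_def D_def C)
  qed
  then have "Gen p n k = enc m ` {z. \<exists>t\<le>m. z = raised lo t}"
    using C raised_tuples by (auto simp: Gen_def)
  \<comment> \<open>Raising to a value below \<open>q\<close>, the least entry of \<open>lo\<close>,
    has the same effect as raising to \<open>q\<close>, so \<open>t\<close> may be taken from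
    \<open>q\<close> on.\<close>
  also have "{z. \<exists>t\<le>m. z = raised lo t} = raised lo ` {q..m}"
  proof -
    have "raised lo t = raised lo (max q t)" for t using lo by auto
    moreover have "max q t \<in> {q..m}" if "t \<le> m" for t using that q_m by simp
    ultimately have "\<exists>s\<in>{q..m}. raised lo t = raised lo s" if "t \<le> m" for t using that by blast
    then show ?thesis by fastforce
  qed
  also have "card (enc m ` raised lo ` {q..m}) = card (raised lo ` {q..m})"
    using inj raised_tuples by (intro card_image inj_on_subset[OF inj]) auto
  also have "card (raised lo ` {q..m}) = card {q..m}"
  proof (intro card_image inj_onI)
    fix s t assume st: "s \<in> {q..m}" "t \<in> {q..m}" "raised lo s = raised lo t"
    then have "\<forall>x\<in>set lo. max s x = max t x" by (simp only: map_eq_conv)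
    \<comment> \<open>The entry \<open>q\<close> of \<open>lo\<close> becomes \<open>t\<close> in
      \<open>raised lo t\<close>, so \<open>t\<close> can be recovered.\<close>
    then have "max s q = max t q" using q_lo by blast
    then show "s = t" using st(1,2) by (simp add: max_def split: if_splits)
  qed
  finally have "card (Gen p n k) = m + 1 - q" by simp
  moreover note q_m
  moreover have "int q = \<lceil>p\<rceil>" using assms(1) by (simp add: q_def)
  ultimately show ?thesis using n by simp
qed

end
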